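(* Let $\delta\in\mathbb{N}^*$ and let $l:[0,\infty)\to\mathbb{R}$ be a decreasing differentiable function with $l(0)>0$ such that there is a constant $\Delta_{\min}>0$ with $l'(t)\ge-\Delta_{\min}$ for all $t\ge0$. For $\varepsilon>0$ let $N^\varepsilon$ be the number of steps of the walk on moving spheres algorithm (A3) (described in the context). Then $N^\varepsilon$ is almost surely finite. Moreover, there exist constants $C_\delta>0$ and $\varepsilon_0(\delta)>0$ such that $$\mathbb{E}[N^\varepsilon]\le C_\delta|\log\varepsilon|\qquad\text{for all }\varepsilon\le\varepsilon_0(\delta).$$ (Here $l$ and $\Delta_{\min}$ are fixed beforehand.)
   Context: Put $\nu=\delta/2-1$. Let $\mathcal{S}^\delta$ be the unit sphere of $\mathbb{R}^\delta$ and $\pi_1:\mathbb{R}^\delta\to\mathbb{R}$ the projection on the first coordinate. For $a>0$ let $$\psi_a(t)=\sqrt{2t\log\frac{a}{\Gamma(\nu+1)t^{\nu+1}2^\nu}},\qquad 0\le t\le\left[\frac{a}{\Gamma(\nu+1)2^\nu}\right]^{1/(\nu+1)}.$$ Let $(U_n,G_n,V_n)_{n\ge1}$ be an i.i.d. sequence where, for each $n$, $U_n$ is uniformly distributed on $[0,1]^{\lfloor\nu\rfloor+2}$ (with coordinates $U_n(1),\dots,U_n(\lfloor\nu\rfloor+2)$), $G_n$ is a standard Gaussian random variable, $V_n$ is uniformly distributed on $\mathcal{S}^\delta$, and $U_n,G_n,V_n$ are independent. Define the constants $$L=\max\left(l(0),\Delta_{\min},\sqrt{\nu+1}\right),\qquad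 \kappa=\frac{2^\nu}{5^{\nu+1}L^{2\nu+2}}\Gamma(\nu+1).$$ Algorithm (A3). Start with $\chi(0)=0$, $\xi_0=0$, $\Xi_0=0$, $A_0=\kappa\,(l(0)-\sqrt{\chi(0)})^{2(\nu+1)}$. For $n\ge1$, if $l(\Xi_{n-1})-\sqrt{\chi(n-1)}>\varepsilon$, set $$\xi_n=\left(\frac{A_{n-1}}{\Gamma(\nu+1)2^\nu}\,U_n(1)\cdots U_n(\lfloor\nu\rfloor+2)\right)^{1/(\nu+1)}\exp\left\{-\frac{\nu-\lfloor\nu\rfloor}{\nu+1}G_n^2\right\},\qquad \Xi_n=\Xi_{n-1}+\xi_n,$$ $$\chi(n)=\chi(n-1)+2\pi_1(V_n)\sqrt{\chi(n-1)}\,\psi_{A_{n-1}}(\xi_n)+\psi_{A_{n-1}}^2(\xi_n),\qquad A_n=\kappa\,\bigl(l(\Xi_n)-\sqrt{\chi(n)}\bigr)^{2(\nu+1)}.$$ Otherwise the algorithm is stopped: $\xi_n=0$, $\Xi_n=\Xi_{n-1}$, $\chi(n)=\chi(n-1)$. The number of steps is $N^\varepsilon=\inf\{n\ge0:\ l(\Xi_n)-\sqrt{\chi(n)}\le\varepsilon\}$. *)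

theory Defs
  imports "HOL-Probability.Probability"
begin

definition nu :: "nat \<Rightarrow> real" where
  "nu \<delta> = real \<delta> / 2 - 1"

text \<open>The number of uniform coordinates. It is at least 1 for \<open>\<delta> \<ge> 1\<close>, since then
  \<open>\<lfloor>nu \<delta>\<rfloor> \<ge> -1\<close>, so the conversion to \<open>nat\<close> does not truncate.\<close>

definition cube_dim :: "nat \<Rightarrow> nat" where
  "cube_dim \<delta> = nat (\<lfloor>nu \<delta>\<rfloor> + 2)"

definition uniform_cube :: "nat \<Rightarrow> (nat \<Rightarrow> real) measure" where
  "uniform_cube m = uniform_measure (PiM {1..m} (\<lambda>_. lborel)) (PiE {1..m} (\<lambda>_. {0..1}))"

text \<open>Normalised surface measure of the unit sphere, as a Borel measure on the ambient space:
  by integration in polar coordinates, the mass of \<open>A \<subseteq> sphere 0 1\<close> is the Lebesgue measure of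
  the cone \<open>{r *\<^sub>R x | r x. 0 < r \<and> r \<le> 1 \<and> x \<in> A}\<close> divided by that of the unit ball. In
  dimension 1 this gives mass 1/2 to each of the points 1 and -1. (The centre of the ball, sent to
  0, is a null set.)\<close>

definition uniform_sphere :: "'v::euclidean_space measure" where
  "uniform_sphere = distr (uniform_measure lborel (cball 0 1)) borel (\<lambda>x. x /\<^sub>R norm x)"

text \<open>The law of a single triple \<open>(U\<^sub>n, G\<^sub>n, V\<^sub>n)\<close>; being a product measure, it makes the three
  components independent with the indicated marginals.\<close>

definition driving_law :: "((nat \<Rightarrow> real) \<times> real \<times> (real^'d)) measure" where
  "driving_law = uniform_cube (cube_dim CARD('d)) \<Otimes>\<^sub>M
     (density lborel (\<lambda>x. ennreal (std_normal_density x)) \<Otimes>\<^sub>M uniform_sphere)"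

definition driving_sequence ::
  "'a measure \<Rightarrow> (nat \<Rightarrow> 'a \<Rightarrow> nat \<Rightarrow> real) \<Rightarrow> (nat \<Rightarrow> 'a \<Rightarrow> real) \<Rightarrow> (nat \<Rightarrow> 'a \<Rightarrow> real^'d) \<Rightarrow> bool"
where
  "driving_sequence M U G V \<longleftrightarrow>
     prob_space M \<and>
     prob_space.indep_vars M (\<lambda>_. driving_law) (\<lambda>n \<omega>. (U n \<omega>, G n \<omega>, V n \<omega>)) {1..} \<and>
     (\<forall>n\<ge>1. distr M driving_law (\<lambda>\<omega>. (U n \<omega>, G n \<omega>, V n \<omega>)) = driving_law)"

definition psi :: "nat \<Rightarrow> real \<Rightarrow> real \<Rightarrow> real" where
  "psi \<delta> a t = sqrt (2 * t * ln (a / (Gamma (nu \<delta> + 1) * t powr (nu \<delta> + 1) * 2 powr nu \<delta>)))"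

definition womsL :: "nat \<Rightarrow> (real \<Rightarrow> real) \<Rightarrow> real \<Rightarrow> real" where
  "womsL \<delta> l \<Delta> = max (l 0) (max \<Delta> (sqrt (nu \<delta> + 1)))"

definition kappa :: "nat \<Rightarrow> (real \<Rightarrow> real) \<Rightarrow> real \<Rightarrow> real" where
  "kappa \<delta> l \<Delta> =
     2 powr nu \<delta> / (5 powr (nu \<delta> + 1) * womsL \<delta> l \<Delta> powr (2 * nu \<delta> + 2)) * Gamma (nu \<delta> + 1)"

text \<open>\<open>A\<^sub>n\<close> as a function of the current state \<open>(\<Xi>\<^sub>n, chi(n))\<close>. It is only used while
  \<open>l(\<Xi>\<^sub>n) - sqrt (chi(n)) > \<epsilon> > 0\<close>, where the base of the power is positive.\<close>

definition sphere_param :: "nat \<Rightarrow> (real \<Rightarrow> real) \<Rightarrow> real \<Rightarrow> real \<times> real \<Rightarrow> real" where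
  "sphere_param \<delta> l \<Delta> = (\<lambda>(\<Xi>, chi). kappa \<delta> l \<Delta> * (l \<Xi> - sqrt chi) powr (2 * (nu \<delta> + 1)))"

definition time_step :: "nat \<Rightarrow> real \<Rightarrow> (nat \<Rightarrow> real) \<Rightarrow> real \<Rightarrow> real" where
  "time_step \<delta> a u g =
     (a / (Gamma (nu \<delta> + 1) * 2 powr nu \<delta>) * (\<Prod>i\<in>{1..cube_dim \<delta>}. u i)) powr (1 / (nu \<delta> + 1))
     * exp (- ((nu \<delta> - of_int \<lfloor>nu \<delta>\<rfloor>) / (nu \<delta> + 1)) * g\<^sup>2)"

text \<open>The state \<open>(\<Xi>\<^sub>n, chi(n))\<close> of algorithm (A3) after \<open>n\<close> steps, driven by the realisations
  \<open>u\<close>, \<open>g\<close>, \<open>v\<close> of the three sequences. The dimension is \<open>CARD('d)\<close>, and \<open>e\<close> is the label of the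
  first coordinate, so that \<open>v n $ e\<close> is \<open>\<pi>\<^sub>1(V\<^sub>n)\<close>.\<close>

primrec walk ::
  "(real \<Rightarrow> real) \<Rightarrow> real \<Rightarrow> 'd \<Rightarrow> real \<Rightarrow> (nat \<Rightarrow> nat \<Rightarrow> real) \<Rightarrow> (nat \<Rightarrow> real) \<Rightarrow> (nat \<Rightarrow> real^'d)
    \<Rightarrow> nat \<Rightarrow> real \<times> real"
where
  "walk l \<Delta> e \<epsilon> u g v 0 = (0, 0)"
| "walk l \<Delta> e \<epsilon> u g v (Suc n) =
    (let (\<Xi>, chi) = walk l \<Delta> e \<epsilon> u g v n in
     if l \<Xi> - sqrt chi > \<epsilon> then
       let a = sphere_param CARD('d) l \<Delta> (\<Xi>, chi);
           \<xi> = time_step CARD('d) a (u (Suc n)) (g (Suc n));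
           p = psi CARD('d) a \<xi>
       in (\<Xi> + \<xi>, chi + 2 * (v (Suc n) $ e) * sqrt chi * p + p\<^sup>2)
     else (\<Xi>, chi))"

text \<open>The infimum of the empty set is \<open>\<infinity>\<close> in \<^typ>\<open>enat\<close>.\<close>

definition num_steps ::
  "(real \<Rightarrow> real) \<Rightarrow> real \<Rightarrow> 'd \<Rightarrow> real \<Rightarrow> (nat \<Rightarrow> nat \<Rightarrow> real) \<Rightarrow> (nat \<Rightarrow> real) \<Rightarrow> (nat \<Rightarrow> real^'d)
    \<Rightarrow> enat"
where
  "num_steps l \<Delta> e \<epsilon> u g v =
     Inf {enat n | n. (case walk l \<Delta> e \<epsilon> u g v n of (\<Xi>, chi) \<Rightarrow> l \<Xi> - sqrt chi \<le> \<epsilon>)}"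

end

theory Submission
  imports Defs
begin

text \<open>Let \<open>R\<^sub>n = l(\<Xi>\<^sub>n) - sqrt (chi(n))\<close>. By scaling, the radius of the \<open>n\<close>-th step is \<open>R\<^sub>n\<close> times
  a factor \<open>q\<close> that depends on \<open>(U, G)\<close> only, and \<open>0 < q < 1\<close> almost surely. As \<open>l\<close> decreases and
  the norm of a vector is at least its first coordinate, \<open>R\<^sub>n\<^sub>+\<^sub>1 \<le> R\<^sub>n * (1 - q * V(1))\<close>. The factors
  \<open>X = 1 - q * V(1)\<close> are i.i.d. and, \<open>V\<close> being symmetric, \<open>\<rho> = E (sqrt X) < 1\<close> by strict concavity.
  Markov's inequality for the product of the \<open>sqrt X\<close> gives
  \<open>P(N > n) \<le> min 1 (sqrt (l 0 / \<epsilon>) * \<rho>^n)\<close>, which is summed over \<open>n\<close>. Only the comparison with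
  an i.i.d. product is needed, so no filtration or stopping-time argument occurs.\<close>

section \<open>Scaling and size of the radius of a single step\<close>

lemma nu_plus_1: "nu \<delta> + 1 = real \<delta> / 2"
  by (simp add: nu_def)

text \<open>The product of the uniform coordinates is strictly below 1 only if it is nonempty. In
  dimension 1 the floor of -1/2 is -1, so exactly one coordinate remains.\<close>

lemma cube_dim_pos: "\<delta> > 0 \<Longrightarrow> 0 < cube_dim \<delta>"
proof -
  assume "\<delta> > 0"
  then have "nu \<delta> \<ge> -1" by (simp add: nu_def)
  then have "\<lfloor>nu \<delta>\<rfloor> \<ge> -1" by linarith
  then show ?thesis by (simp add: cube_dim_def)
qed

lemma time_step_nonneg: "0 \<le> time_step \<delta> a u g"
  by (simp add: time_step_def)

text \<open>Brownian scaling: the outer exponent \<open>1 / (nu \<delta> + 1)\<close> turns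
  \<open>R powr (2 * (nu \<delta> + 1))\<close> into the square of \<open>R\<close>, so times scale
  as squared lengths.\<close>

lemma time_step_scale:
  assumes "\<delta> > 0" "R > 0" "a > 0" "0 \<le> (\<Prod>i\<in>{1..cube_dim \<delta>}. u i)"
  shows "time_step \<delta> (a * R powr (2 * (nu \<delta> + 1))) u g = R\<^sup>2 * time_step \<delta> a u g"
proof -
  let ?P = "\<Prod>i\<in>{1..cube_dim \<delta>}. u i" and ?D = "Gamma (nu \<delta> + 1) * 2 powr nu \<delta>"
  have s: "nu \<delta> + 1 > 0" using assms by (simp add: nu_plus_1)
  have D: "?D > 0" using s by (simp add: Gamma_real_pos)
  have "(a * R powr (2 * (nu \<delta> + 1)) / ?D * ?P) powr (1 / (nu \<delta> + 1))
    = (R powr (2 * (nu \<delta> + 1)) * (a / ?D * ?P)) powr (1 / (nu \<delta> + 1))"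
    by (simp add: mult_ac)
  also have "\<dots> = (R powr (2 * (nu \<delta> + 1))) powr (1 / (nu \<delta> + 1)) * (a / ?D * ?P) powr (1 / (nu \<delta> + 1))"
    by (rule powr_mult)
  also have "(R powr (2 * (nu \<delta> + 1))) powr (1 / (nu \<delta> + 1)) = R\<^sup>2"
  proof -
    have "2 * (nu \<delta> + 1) * (1 / (nu \<delta> + 1)) = 2" using s by (simp add: field_simps)
    then show ?thesis using assms by (simp only: powr_powr powr_numeral)
  qed
  finally show ?thesis by (simp add: time_step_def)
qed

text \<open>The powers of \<open>R\<close> cancel in the argument of the logarithm. What remains is
  the square of \<open>R\<close> in front of it, which leaves the root as a factor
  \<open>R\<close>.\<close>

lemma psi_scale:
  assumes "\<delta> > 0" "R > 0" "0 \<le> t"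
  shows "psi \<delta> (a * R powr (2 * (nu \<delta> + 1))) (R\<^sup>2 * t) = R * psi \<delta> a t"
proof -
  have "(R\<^sup>2 * t) powr (nu \<delta> + 1) = R powr (2 * (nu \<delta> + 1)) * t powr (nu \<delta> + 1)"
    using assms by (simp add: powr_mult powr_powr flip: powr_numeral)
  then have "a * R powr (2 * (nu \<delta> + 1)) / (Gamma (nu \<delta> + 1) * (R\<^sup>2 * t) powr (nu \<delta> + 1) * 2 powr nu \<delta>)
     = a / (Gamma (nu \<delta> + 1) * t powr (nu \<delta> + 1) * 2 powr nu \<delta>)"
    using assms by simp
  then have "psi \<delta> (a * R powr (2 * (nu \<delta> + 1))) (R\<^sup>2 * t) =
     sqrt (R\<^sup>2 * (2 * t * ln (a / (Gamma (nu \<delta> + 1) * t powr (nu \<delta> + 1) * 2 powr nu \<delta>))))"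
    by (simp add: psi_def mult_ac)
  also have "\<dots> = R * psi \<delta> a t"
    using assms by (simp add: psi_def real_sqrt_mult)
  finally show ?thesis .
qed

text \<open>\<open>T\<close> is the right end of the interval on which \<open>psi\<close> is
  considered, and the time step is \<open>T * w\<close> with \<open>0 < w < 1\<close>. There the
  square of \<open>psi\<close> equals \<open>\<delta> * T * (w * ln (1 / w))\<close>, and the last
  factor lies in (0, 1].\<close>

lemma psi_bounds:
  assumes "\<delta> > 0" "a > 0"
    and P: "0 < (\<Prod>i\<in>{1..cube_dim \<delta>}. u i)" "(\<Prod>i\<in>{1..cube_dim \<delta>}. u i) < 1"
  defines "T \<equiv> (a / (Gamma (nu \<delta> + 1) * 2 powr nu \<delta>)) powr (1 / (nu \<delta> + 1))"
  shows "0 < psi \<delta> a (time_step \<delta> a u g)"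
    and "(psi \<delta> a (time_step \<delta> a u g))\<^sup>2 \<le> real \<delta> * T"
proof -
  let ?P = "\<Prod>i\<in>{1..cube_dim \<delta>}. u i" and ?D = "Gamma (nu \<delta> + 1) * 2 powr nu \<delta>"
  define s where "s = nu \<delta> + 1"
  define t where "t = time_step \<delta> a u g"
  have s: "s > 0" using assms by (simp add: s_def nu_plus_1)
  have D: "?D > 0" using s by (simp add: s_def Gamma_real_pos)
  have T: "T > 0" using D \<open>a > 0\<close> unfolding T_def by (metis divide_pos_pos powr_gt_zero less_irrefl)
  have Ts: "T powr s = a / ?D" using D s assms by (simp add: T_def powr_powr s_def)
  define w where "w = ?P powr (1 / s) * exp (- ((nu \<delta> - of_int \<lfloor>nu \<delta>\<rfloor>) / s) * g\<^sup>2)"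
  have t: "t = T * w"
    by (simp only: t_def time_step_def T_def w_def s_def powr_mult mult.assoc)
  have w0: "w > 0" unfolding w_def using P by (metis mult_pos_pos powr_gt_zero exp_gt_zero less_irrefl)
  have "?P powr (1 / s) < 1" using P s powr_less_mono2[of "1 / s" ?P 1] by simp
  moreover have "exp (- ((nu \<delta> - of_int \<lfloor>nu \<delta>\<rfloor>) / s) * g\<^sup>2) \<le> 1"
    using s by simp
  ultimately have w1: "w < 1"
    unfolding w_def by (smt (verit) mult_le_cancel_left1 powr_ge_zero exp_ge_zero mult_left_le)
  have "a / (Gamma (nu \<delta> + 1) * t powr (nu \<delta> + 1) * 2 powr nu \<delta>) = T powr s / t powr s"
    using Ts by (simp add: s_def mult_ac)
  also have "\<dots> = (1 / w) powr s" using T w0 by (simp add: t powr_divide powr_mult)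
  finally have *: "ln (a / (Gamma (nu \<delta> + 1) * t powr (nu \<delta> + 1) * 2 powr nu \<delta>)) = s * ln (1 / w)"
    using w0 by (simp add: ln_powr)
  have psi: "psi \<delta> a t = sqrt (2 * s * T * (w * ln (1 / w)))"
    unfolding psi_def * by (simp add: t mult_ac)
  have pos: "0 < w * ln (1 / w)" using w0 w1 by (intro mult_pos_pos) simp_all
  have "ln (1 / w) \<le> 1 / w - 1" using w0 by (intro ln_le_minus_one) simp
  then have "w * ln (1 / w) \<le> w * (1 / w - 1)" using w0 by (intro mult_left_mono) auto
  also have "\<dots> \<le> 1" using w0 by (simp add: algebra_simps)
  finally have le: "w * ln (1 / w) \<le> 1" .
  show "0 < psi \<delta> a (time_step \<delta> a u g)"
    unfolding t_def[symmetric] psi using s T pos by simp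
  have "(psi \<delta> a t)\<^sup>2 = 2 * s * T * (w * ln (1 / w))"
    unfolding psi using s T pos by simp
  also have "\<dots> \<le> 2 * s * T" using le s T by (intro mult_left_le) auto
  finally show "(psi \<delta> a (time_step \<delta> a u g))\<^sup>2 \<le> real \<delta> * T"
    by (simp add: t_def s_def nu_plus_1)
qed

lemma kappa_pos: "\<delta> > 0 \<Longrightarrow> \<Delta> > 0 \<Longrightarrow> kappa \<delta> l \<Delta> > 0"
  by (simp add: kappa_def womsL_def nu_plus_1 Gamma_real_pos)

text \<open>For \<open>a = kappa\<close> the end point \<open>T\<close> of \<open>psi_bounds\<close>
  is \<open>1 / (5 * L\<^sup>2)\<close>. The entry \<open>sqrt (nu \<delta> + 1)\<close> in the
  maximum \<open>L\<close> makes \<open>L\<^sup>2\<close> at least \<open>\<delta> / 2\<close>, so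
  the square of the radius is at most 2/5.\<close>

lemma psi_kappa_less_1:
  assumes "\<delta> > 0" "\<Delta> > 0"
    and P: "0 < (\<Prod>i\<in>{1..cube_dim \<delta>}. u i)" "(\<Prod>i\<in>{1..cube_dim \<delta>}. u i) < 1"
  shows "psi \<delta> (kappa \<delta> l \<Delta>) (time_step \<delta> (kappa \<delta> l \<Delta>) u g) < 1"
proof -
  define k where "k = kappa \<delta> l \<Delta>"
  define L where "L = womsL \<delta> l \<Delta>"
  define s where "s = nu \<delta> + 1"
  have s: "s > 0" using assms by (simp add: s_def nu_plus_1)
  have L: "L > 0" using assms by (simp add: L_def womsL_def)
  have "L \<ge> sqrt s" by (simp add: L_def womsL_def s_def)
  then have Ls: "L\<^sup>2 \<ge> s" using s L by (metis less_eq_real_def real_sqrt_le_iff real_sqrt_unique)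
  have kp: "k > 0" using kappa_pos assms by (simp add: k_def)
  have "k / (Gamma (nu \<delta> + 1) * 2 powr nu \<delta>) = 1 / (5 powr s * L powr (2 * s))"
    using s Gamma_real_pos[OF s[unfolded s_def], THEN less_imp_neq] L by (simp add: k_def kappa_def s_def flip: L_def)
  also have "\<dots> = (1 / (5 * L\<^sup>2)) powr s"
    using L s by (simp add: powr_divide powr_mult powr_powr flip: powr_numeral)
  finally have T: "(k / (Gamma (nu \<delta> + 1) * 2 powr nu \<delta>)) powr (1 / (nu \<delta> + 1)) = 1 / (5 * L\<^sup>2)"
    using s L by (simp add: powr_powr s_def)
  have "(psi \<delta> k (time_step \<delta> k u g))\<^sup>2 \<le> real \<delta> * (1 / (5 * L\<^sup>2))"
    using psi_bounds(2)[OF \<open>\<delta> > 0\<close> kp P, of g] by (simp only: T)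
  also have "real \<delta> = 2 * s" by (simp add: s_def nu_plus_1)
  also have "2 * s * (1 / (5 * L\<^sup>2)) \<le> 2 / 5"
    using Ls L by (simp add: field_simps)
  finally have "(psi \<delta> k (time_step \<delta> k u g))\<^sup>2 < 1" by simp
  then show ?thesis unfolding k_def by (simp add: power_less_one_iff abs_square_less_1)
qed

lemma prod_unit_interval:
  assumes "\<delta> > 0" "\<And>i. i \<in> {1..cube_dim \<delta>} \<Longrightarrow> 0 < u i \<and> u i < (1::real)"
  shows "0 < (\<Prod>i\<in>{1..cube_dim \<delta>}. u i)" "(\<Prod>i\<in>{1..cube_dim \<delta>}. u i) < 1"
proof -
  show "0 < (\<Prod>i\<in>{1..cube_dim \<delta>}. u i)" using assms by (intro prod_pos) auto
  have "(\<Prod>i\<in>{1..cube_dim \<delta>}. u i) < (\<Prod>i\<in>{1..cube_dim \<delta>}. 1)"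
    using assms cube_dim_pos[of \<delta>] by (intro prod_mono_strict) (auto intro: less_imp_le)
  then show "(\<Prod>i\<in>{1..cube_dim \<delta>}. u i) < 1" by simp
qed

text \<open>With \<open>a = kappa\<close> and \<open>R\<close> the current gap, the left side is the
  radius used by the algorithm, and the right side is \<open>R\<close> times a factor that does not
  depend on the state.\<close>

lemma psi_scale_time_step:
  assumes "\<delta> > 0" "R > 0" "a > 0" "0 \<le> (\<Prod>i\<in>{1..cube_dim \<delta>}. u i)"
  shows "psi \<delta> (a * R powr (2 * (nu \<delta> + 1))) (time_step \<delta> (a * R powr (2 * (nu \<delta> + 1))) u g)
    = R * psi \<delta> a (time_step \<delta> a u g)"
  using assms by (simp only: time_step_scale psi_scale time_step_nonneg)

section \<open>The uniform laws on the sphere and on the cube\<close>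

lemma prob_space_uniform_sphere: "prob_space (uniform_sphere :: 'v::euclidean_space measure)"
proof -
  have "emeasure lborel (cball (0::'v) 1) \<noteq> 0" "emeasure lborel (cball (0::'v) 1) \<noteq> \<infinity>"
    using content_cball_pos[of 1 "0::'v"] emeasure_lborel_cball_finite[of "0::'v" 1]
    by (auto simp: measure_def)
  then have "prob_space (uniform_measure lborel (cball (0::'v) 1))"
    by (rule prob_space_uniform_measure)
  then show ?thesis
    unfolding uniform_sphere_def by (rule prob_space.prob_space_distr) simp
qed

lemma sets_uniform_sphere [measurable_cong]:
  "sets (uniform_sphere :: 'v::euclidean_space measure) = sets borel"
  by (simp add: uniform_sphere_def)

lemma distr_lborel_uminus: "distr lborel borel uminus = (lborel :: 'v::euclidean_space measure)"
  by (subst (2) lborel_affine[of "-1" 0]) (auto simp: density_1 one_ennreal_def[symmetric])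

text \<open>Lebesgue measure on the ball is invariant under negation, and negation commutes with
  division by the norm.\<close>

lemma distr_uniform_sphere_uminus:
  "distr uniform_sphere borel uminus = (uniform_sphere :: 'v::euclidean_space measure)"
proof -
  let ?B = "cball (0::'v) 1"
  let ?U = "uniform_measure lborel ?B"
  have "distr ?U borel uminus = ?U"
  proof (rule measure_eqI)
    fix A assume "A \<in> sets (distr ?U borel uminus)"
    then have [measurable]: "A \<in> sets borel" by simp
    have "uminus -` A \<in> sets (borel :: 'v measure)"
      using measurable_sets_borel[of "uminus :: 'v \<Rightarrow> 'v" borel A] by simp
    then have "emeasure (distr ?U borel uminus) A = emeasure lborel (?B \<inter> uminus -` A) / emeasure lborel ?B"
      by (simp add: emeasure_distr)
    also have "?B \<inter> uminus -` A = uminus -` (?B \<inter> A)" by auto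
    also have "emeasure lborel \<dots> = emeasure (distr lborel borel uminus) (?B \<inter> A)"
      by (simp add: emeasure_distr)
    finally show "emeasure (distr ?U borel uminus) A = emeasure ?U A"
      by (simp add: distr_lborel_uminus)
  qed simp
  then have "uniform_sphere = distr (distr ?U borel uminus) borel (\<lambda>x. x /\<^sub>R norm x)"
    by (simp add: uniform_sphere_def)
  also have "\<dots> = distr uniform_sphere borel uminus"
    by (simp add: uniform_sphere_def distr_distr comp_def)
  finally show ?thesis by simp
qed

text \<open>A coordinate hyperplane is Lebesgue null, and dividing by the norm turns no nonzero
  coordinate into zero. That the coordinate is nonzero later makes the concavity inequality
  strict.\<close>

lemma AE_uniform_sphere:
  "AE v in (uniform_sphere :: (real^'d) measure). \<bar>v $ e\<bar> \<le> 1 \<and> v $ e \<noteq> 0"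
proof -
  have "AE x in lebesgue. (x :: real^'d) $ e \<noteq> 0"
    using negligible_standard_hyperplane_cart[of e]
    by (intro AE_I'[of "{x. x $ e = 0}"]) (auto simp: negligible_iff_null_sets)
  then have "AE x in lborel. (x :: real^'d) $ e \<noteq> 0"
    by (simp add: AE_completion_iff)
  then have "AE x in uniform_measure lborel (cball 0 1). (x :: real^'d) $ e \<noteq> 0"
    by (intro AE_uniform_measureI) auto
  then have "AE x in uniform_measure lborel (cball 0 1).
      \<bar>((x :: real^'d) /\<^sub>R norm x) $ e\<bar> \<le> 1 \<and> (x /\<^sub>R norm x) $ e \<noteq> 0"
  proof (rule eventually_mono)
    fix x :: "real^'d" assume x: "x $ e \<noteq> 0"
    then have "x \<noteq> 0" by auto
    then show "\<bar>(x /\<^sub>R norm x) $ e\<bar> \<le> 1 \<and> (x /\<^sub>R norm x) $ e \<noteq> 0"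
      using x component_le_norm_cart[of "x /\<^sub>R norm x" e] by simp
  qed
  then show ?thesis
    unfolding uniform_sphere_def by (subst AE_distr_iff) auto
qed

text \<open>The open and the closed unit cube have the same mass 1. Working in the open cube keeps
  the product of the coordinates strictly between 0 and 1.\<close>

lemma
  shows prob_space_uniform_cube: "prob_space (uniform_cube m)"
    and AE_uniform_cube: "AE u in uniform_cube m. \<forall>i\<in>{1..m}. 0 < u i \<and> u i < 1"
proof -
  interpret product_sigma_finite "\<lambda>_::nat. lborel :: real measure"
    by unfold_locales
  let ?M = "PiM {1..m} (\<lambda>_. lborel :: real measure)"
  let ?C = "PiE {1..m} (\<lambda>_. {0..1::real})" and ?I = "PiE {1..m} (\<lambda>_. {0<..<1::real})"
  have C: "emeasure ?M ?C = 1" and I: "emeasure ?M ?I = 1"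
    by (simp_all add: emeasure_PiM)
  show P: "prob_space (uniform_cube m)"
    unfolding uniform_cube_def by (rule prob_space_uniform_measure) (use C in simp_all)
  have S: "?C \<in> sets ?M" "?I \<in> sets ?M" by auto
  have "?C \<inter> ?I = ?I" by (intro Int_absorb1 PiE_mono) auto
  then have "emeasure (uniform_cube m) ?I = 1"
    using S C I by (simp add: uniform_cube_def)
  then have "AE u in uniform_cube m. u \<in> ?I"
    using S by (subst prob_space.AE_in_set_eq_1[OF P]) (simp_all add: uniform_cube_def measure_def)
  then show "AE u in uniform_cube m. \<forall>i\<in>{1..m}. 0 < u i \<and> u i < 1"
    by (rule eventually_mono) (auto simp: PiE_iff)
qed

lemma sets_uniform_cube [measurable_cong]:
  "sets (uniform_cube m) = sets (PiM {1..m} (\<lambda>_. lborel))"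
  by (simp add: uniform_cube_def)

section \<open>Pathwise comparison of the gap with a product of factors\<close>

text \<open>This is the factor \<open>X = 1 - q * V(1)\<close>. Here \<open>q\<close> is the radius
  of a step taken from gap 1, where the sphere parameter equals \<open>kappa\<close>.\<close>

definition shrink :: "(real \<Rightarrow> real) \<Rightarrow> real \<Rightarrow> 'd \<Rightarrow> (nat \<Rightarrow> real) \<times> real \<times> (real^'d) \<Rightarrow> real" where
  "shrink l \<Delta> e = (\<lambda>(u, g, v). 1 - psi CARD('d) (kappa CARD('d) l \<Delta>)
     (time_step CARD('d) (kappa CARD('d) l \<Delta>) u g) * v $ e)"

abbreviation gap :: "(real \<Rightarrow> real) \<Rightarrow> real \<times> real \<Rightarrow> real" where
  "gap l \<equiv> (\<lambda>(\<Xi>, chi). l \<Xi> - sqrt chi)"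

text \<open>Writing \<open>x = sqrt chi\<close> and \<open>c\<close> for the first coordinate of the
  direction, \<open>chi'\<close> exceeds \<open>(x + p * c)\<^sup>2\<close> by
  \<open>p\<^sup>2 * (1 - c\<^sup>2)\<close>, which is nonnegative. Hence \<open>sqrt chi'\<close>
  is at least \<open>x + p * c\<close>. The time increment can only lower \<open>l\<close>, and
  scaling writes \<open>p\<close> as the old gap times \<open>q\<close>.\<close>

lemma walk_step:
  fixes e :: "'d::finite" and v :: "nat \<Rightarrow> real^'d"
  assumes l: "antimono_on {0..} l" and "\<Delta> > 0" "\<epsilon> > 0"
    and w: "walk l \<Delta> e \<epsilon> u g v n = (\<Xi>, chi)" "0 \<le> \<Xi>" "0 \<le> chi" "l \<Xi> - sqrt chi > \<epsilon>"
    and u: "\<And>i. i \<in> {1..cube_dim CARD('d)} \<Longrightarrow> 0 < u (Suc n) i"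
    and v: "\<bar>v (Suc n) $ e\<bar> \<le> 1"
    and w': "walk l \<Delta> e \<epsilon> u g v (Suc n) = (\<Xi>', chi')"
  shows "0 \<le> \<Xi>'" "0 \<le> chi'"
    and "l \<Xi>' - sqrt chi' \<le> (l \<Xi> - sqrt chi) * shrink l \<Delta> e (u (Suc n), g (Suc n), v (Suc n))"
proof -
  define a where "a = sphere_param CARD('d) l \<Delta> (\<Xi>, chi)"
  define t where "t = time_step CARD('d) a (u (Suc n)) (g (Suc n))"
  define p where "p = psi CARD('d) a t"
  define x where "x = sqrt chi"
  define c where "c = v (Suc n) $ e"
  have Xi': "\<Xi>' = \<Xi> + t" and chi': "chi' = chi + 2 * c * x * p + p\<^sup>2"
    using w' w by (simp_all add: a_def t_def p_def x_def c_def Let_def)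
  have t: "0 \<le> t" by (simp add: t_def time_step_nonneg)
  have x: "0 \<le> x" "x\<^sup>2 = chi" using w by (simp_all add: x_def)
  have "c\<^sup>2 \<le> 1" using v by (simp add: c_def abs_square_le_1)
  then have "(p * c)\<^sup>2 \<le> p\<^sup>2" by (simp add: power_mult_distrib mult_left_le)
  then have sq: "(x + p * c)\<^sup>2 \<le> chi'" by (simp add: chi' power2_sum x mult_ac)
  then show "0 \<le> chi'" by (meson order_trans zero_le_power2)
  show Xi'0: "0 \<le> \<Xi>'" using w t by (simp add: Xi')
  have sqrt: "x + p * c \<le> sqrt chi'" using sq by (rule real_le_rsqrt)
  have "l \<Xi>' \<le> l \<Xi>" using l w t by (auto simp: Xi' monotone_on_def)
  then have "l \<Xi>' - sqrt chi' \<le> (l \<Xi> - x) - p * c" using sqrt by simp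
  also have "p = (l \<Xi> - x) * psi CARD('d) (kappa CARD('d) l \<Delta>)
      (time_step CARD('d) (kappa CARD('d) l \<Delta>) (u (Suc n)) (g (Suc n)))"
    unfolding p_def t_def a_def sphere_param_def x_def prod.case
    using w \<open>\<epsilon> > 0\<close> \<open>\<Delta> > 0\<close> u by (intro psi_scale_time_step kappa_pos prod_nonneg) (auto intro: less_imp_le)
  finally show "l \<Xi>' - sqrt chi' \<le> (l \<Xi> - sqrt chi) * shrink l \<Delta> e (u (Suc n), g (Suc n), v (Suc n))"
    by (simp add: shrink_def x_def c_def algebra_simps)
qed

text \<open>Iterates \<open>walk_step\<close> along a path that has not stopped. The signs of the
  two state components are carried along because each further step requires them.\<close>

lemma gap_le_prod_shrink:
  fixes e :: "'d::finite" and v :: "nat \<Rightarrow> real^'d"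
  assumes l: "antimono_on {0..} l" and "\<Delta> > 0" "\<epsilon> > 0"
    and u: "\<And>n i. n \<ge> 1 \<Longrightarrow> i \<in> {1..cube_dim CARD('d)} \<Longrightarrow> 0 < u n i"
    and v: "\<And>n. n \<ge> 1 \<Longrightarrow> \<bar>v n $ e\<bar> \<le> 1"
    and running: "\<And>k. k \<le> n \<Longrightarrow> gap l (walk l \<Delta> e \<epsilon> u g v k) > \<epsilon>"
  shows "0 \<le> fst (walk l \<Delta> e \<epsilon> u g v n) \<and> 0 \<le> snd (walk l \<Delta> e \<epsilon> u g v n) \<and>
    gap l (walk l \<Delta> e \<epsilon> u g v n) \<le> l 0 * (\<Prod>k=1..n. max 0 (shrink l \<Delta> e (u k, g k, v k)))"
  using running
proof (induction n)
  case 0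
  then show ?case by simp
next
  case (Suc n)
  let ?s = "shrink l \<Delta> e (u (Suc n), g (Suc n), v (Suc n))"
  obtain \<Xi> chi where w: "walk l \<Delta> e \<epsilon> u g v n = (\<Xi>, chi)" by fastforce
  obtain \<Xi>' chi' where w': "walk l \<Delta> e \<epsilon> u g v (Suc n) = (\<Xi>', chi')" by fastforce
  have IH: "0 \<le> \<Xi>" "0 \<le> chi"
    "l \<Xi> - sqrt chi \<le> l 0 * (\<Prod>k=1..n. max 0 (shrink l \<Delta> e (u k, g k, v k)))"
    using Suc by (simp_all add: w del: walk.simps)
  have run: "l \<Xi> - sqrt chi > \<epsilon>" using Suc.prems[of n] by (simp add: w)
  have "l \<Xi>' - sqrt chi' \<le> (l \<Xi> - sqrt chi) * ?s"
    using walk_step(3)[OF l \<open>\<Delta> > 0\<close> \<open>\<epsilon> > 0\<close> w IH(1,2) run u v w'] by simp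
  \<comment> \<open>The old gap is positive, so truncating the factor at 0 only enlarges the bound.
    The truncated factor may multiply the induction hypothesis, and its square root is
    multiplicative in the product.\<close>
  also have "\<dots> \<le> (l \<Xi> - sqrt chi) * max 0 ?s"
    using run \<open>\<epsilon> > 0\<close> by (intro mult_left_mono) auto
  also have "\<dots> \<le> (l 0 * (\<Prod>k=1..n. max 0 (shrink l \<Delta> e (u k, g k, v k)))) * max 0 ?s"
    using IH(3) by (intro mult_right_mono) auto
  finally show ?case
    using walk_step(1,2)[OF l \<open>\<Delta> > 0\<close> \<open>\<epsilon> > 0\<close> w IH(1,2) run u v w']
    by (simp add: w' mult_ac del: walk.simps)
qed

text \<open>The tail sum of a first hitting time \<open>N\<close>: the term with index
  \<open>n\<close> is 1 exactly when \<open>n < N\<close>. If \<open>P\<close> never holds, every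
  term is 1 and both sides are infinite.\<close>

lemma ennreal_of_enat_Inf_le:
  "ennreal_of_enat (Inf {enat n |n. P n}) \<le> (\<Sum>n. if \<forall>k\<le>n. \<not> P k then 1 else 0)"
  (is "_ \<le> suminf ?f")
proof -
  have *: "of_nat N \<le> suminf ?f" if "\<And>k. k < N \<Longrightarrow> \<not> P k" for N
  proof -
    have "of_nat N = (\<Sum>n<N. 1 :: ennreal)" by simp
    also have "\<dots> = sum ?f {..<N}" by (rule sum.cong) (use that in auto)
    also have "\<dots> \<le> suminf ?f" by (intro sum_le_suminf summableI) auto
    finally show ?thesis .
  qed
  show ?thesis
  proof (cases "\<exists>n. P n")
    case True
    define N where "N = (LEAST n. P n)"
    have N: "P N" "\<And>k. k < N \<Longrightarrow> \<not> P k"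
      unfolding N_def using LeastI_ex[OF True] not_less_Least by blast+
    have "Inf {enat n |n. P n} \<le> enat N" using N(1) by (intro Inf_lower) blast
    then have "ennreal_of_enat (Inf {enat n |n. P n}) \<le> of_nat N"
      by (simp flip: ennreal_of_enat_enat)
    also have "\<dots> \<le> suminf ?f" using N(2) by (rule *)
    finally show ?thesis .
  next
    case False
    then have le: "of_nat N \<le> suminf ?f" for N by (intro *) auto
    have "suminf ?f = top"
    proof (rule ccontr)
      assume "suminf ?f \<noteq> top"
      then obtain N where "suminf ?f < of_nat N"
        using ennreal_Ex_less_of_nat[of "suminf ?f"] less_top by blast
      with le[of N] show False by simp
    qed
    then show ?thesis by simp
  qed
qed

section \<open>The law of one driving triple and the mean of the root of its factor\<close>

lemma borel_measurable_nth_compose [measurable (raw)]: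
  fixes f :: "'a \<Rightarrow> real^'d"
  shows "f \<in> borel_measurable M \<Longrightarrow> (\<lambda>x. f x $ i) \<in> borel_measurable M"
  using borel_measurable_nth by (rule measurable_compose[rotated])

lemma prob_space_driving_law: "prob_space (driving_law :: ((nat \<Rightarrow> real) \<times> real \<times> (real^'d)) measure)"
proof -
  have N: "prob_space (density lborel (\<lambda>x. ennreal (std_normal_density x)))"
    by (intro prob_space_normal_density) simp
  show ?thesis
    unfolding driving_law_def
    by (intro prob_space_pair prob_space_uniform_cube prob_space_uniform_sphere N)
qed

lemma borel_measurable_uniform_cube_component:
  "i \<in> {1..m} \<Longrightarrow> (\<lambda>u. u i) \<in> borel_measurable (uniform_cube m)"
  by (simp add: measurable_component_singleton[THEN measurable_compose] uniform_cube_def measurable_def cong: measurable_cong_sets)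

lemma borel_measurable_shrink [measurable]:
  "shrink l \<Delta> e \<in> borel_measurable (driving_law :: ((nat \<Rightarrow> real) \<times> real \<times> (real^'d)) measure)"
proof -
  have [measurable]: "(\<lambda>x. fst x i) \<in> borel_measurable
      (driving_law :: ((nat \<Rightarrow> real) \<times> real \<times> (real^'d)) measure)"
    if "i \<in> {1..cube_dim CARD('d)}" for i
    unfolding driving_law_def
    using borel_measurable_uniform_cube_component[OF that] by (rule measurable_fst'')
  have [measurable]: "(\<lambda>x. fst (snd x)) \<in> borel_measurable
      (driving_law :: ((nat \<Rightarrow> real) \<times> real \<times> (real^'d)) measure)"
    unfolding driving_law_def by measurable
  have [measurable]: "(\<lambda>x. snd (snd x) $ e) \<in> borel_measurable
      (driving_law :: ((nat \<Rightarrow> real) \<times> real \<times> (real^'d)) measure)"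
    unfolding driving_law_def by measurable
  show ?thesis
    unfolding shrink_def case_prod_beta' psi_def time_step_def by measurable
qed

lemma
  fixes e :: "'d::finite"
  defines "D \<equiv> (driving_law :: ((nat \<Rightarrow> real) \<times> real \<times> (real^'d)) measure)"
  shows AE_driving_law_cube: "AE x in D. \<forall>i\<in>{1..cube_dim CARD('d)}. 0 < fst x i \<and> fst x i < 1"
    and AE_driving_law_sphere: "AE x in D. \<bar>snd (snd x) $ e\<bar> \<le> 1 \<and> snd (snd x) $ e \<noteq> 0"
proof -
  let ?C = "uniform_cube (cube_dim CARD('d))"
  let ?N = "density lborel (\<lambda>x. ennreal (std_normal_density x))"
  let ?S = "uniform_sphere :: (real^'d) measure"
  interpret C: prob_space ?C by (rule prob_space_uniform_cube)
  interpret N: prob_space ?N by (intro prob_space_normal_density) simp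
  interpret S: prob_space ?S by (rule prob_space_uniform_sphere)
  interpret NS: pair_prob_space ?N ?S by unfold_locales
  interpret CNS: pair_prob_space ?C "?N \<Otimes>\<^sub>M ?S" by unfold_locales
  have "AE u in distr (?C \<Otimes>\<^sub>M (?N \<Otimes>\<^sub>M ?S)) ?C fst. \<forall>i\<in>{1..cube_dim CARD('d)}. 0 < u i \<and> u i < 1"
    unfolding NS.distr_pair_fst by (rule AE_uniform_cube)
  then show "AE x in D. \<forall>i\<in>{1..cube_dim CARD('d)}. 0 < fst x i \<and> fst x i < 1"
    unfolding D_def driving_law_def by (rule AE_distrD[rotated]) simp
  show "AE x in D. \<bar>snd (snd x) $ e\<bar> \<le> 1 \<and> snd (snd x) $ e \<noteq> 0"
    unfolding D_def driving_law_def
  proof (rule CNS.AE_pair_measure)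
    have "AE y in ?N \<Otimes>\<^sub>M ?S. \<bar>snd y $ e\<bar> \<le> 1 \<and> snd y $ e \<noteq> 0"
    proof (rule NS.AE_pair_measure)
      show "AE x in ?N. AE v in ?S. \<bar>snd (x, v) $ e\<bar> \<le> 1 \<and> snd (x, v) $ e \<noteq> 0"
        using AE_uniform_sphere[of e] by simp
    qed measurable
    then show "AE x in ?C. AE y in ?N \<Otimes>\<^sub>M ?S. \<bar>snd (snd (x, y)) $ e\<bar> \<le> 1 \<and> snd (snd (x, y)) $ e \<noteq> 0"
      by simp
  qed measurable
qed

text \<open>By Tonelli the direction can be integrated innermost. For fixed \<open>u\<close> and
  \<open>g\<close> the claim is then the symmetry of the sphere.\<close>

lemma nn_integral_driving_law_uminus:
  fixes f :: "(nat \<Rightarrow> real) \<times> real \<times> (real^'d) \<Rightarrow> ennreal"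
  assumes f: "f \<in> borel_measurable driving_law"
  shows "(\<integral>\<^sup>+ x. f (fst x, fst (snd x), - snd (snd x)) \<partial>driving_law) = integral\<^sup>N driving_law f"
proof -
  let ?C = "uniform_cube (cube_dim CARD('d))"
  let ?N = "density lborel (\<lambda>x. ennreal (std_normal_density x))"
  let ?S = "uniform_sphere :: (real^'d) measure"
  interpret C: prob_space ?C by (rule prob_space_uniform_cube)
  interpret N: prob_space ?N by (intro prob_space_normal_density) simp
  interpret S: prob_space ?S by (rule prob_space_uniform_sphere)
  interpret NS: pair_prob_space ?N ?S by unfold_locales
  have [measurable]: "f \<in> borel_measurable (?C \<Otimes>\<^sub>M (?N \<Otimes>\<^sub>M ?S))"
    using f by (simp add: driving_law_def)
  have *: "(\<integral>\<^sup>+ v. f (u, g, - v) \<partial>?S) = (\<integral>\<^sup>+ v. f (u, g, v) \<partial>?S)" if [measurable]: "u \<in> space ?C" for u g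
  proof -
    have [measurable]: "(\<lambda>v. f (u, g, v)) \<in> borel_measurable ?S" by measurable
    have "(\<integral>\<^sup>+ v. f (u, g, v) \<partial>distr ?S borel uminus) = (\<integral>\<^sup>+ v. f (u, g, - v) \<partial>?S)"
      by (subst nn_integral_distr) measurable
    then show ?thesis by (simp add: distr_uniform_sphere_uminus)
  qed
  have "(\<integral>\<^sup>+ x. f (fst x, fst (snd x), - snd (snd x)) \<partial>(?C \<Otimes>\<^sub>M (?N \<Otimes>\<^sub>M ?S)))
      = (\<integral>\<^sup>+ u. \<integral>\<^sup>+ y. f (u, fst y, - snd y) \<partial>(?N \<Otimes>\<^sub>M ?S) \<partial>?C)"
    by (subst NS.nn_integral_fst[symmetric]) simp_all
  also have "\<dots> = (\<integral>\<^sup>+ u. \<integral>\<^sup>+ g. \<integral>\<^sup>+ v. f (u, g, - v) \<partial>?S \<partial>?N \<partial>?C)"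
    by (intro nn_integral_cong, subst S.nn_integral_fst[symmetric]) simp_all
  also have "\<dots> = (\<integral>\<^sup>+ u. \<integral>\<^sup>+ g. \<integral>\<^sup>+ v. f (u, g, v) \<partial>?S \<partial>?N \<partial>?C)"
    by (rule nn_integral_cong, rule nn_integral_cong, rule *)
  also have "\<dots> = (\<integral>\<^sup>+ u. \<integral>\<^sup>+ y. f (u, y) \<partial>(?N \<Otimes>\<^sub>M ?S) \<partial>?C)"
    by (intro nn_integral_cong, subst S.nn_integral_fst[symmetric]) simp_all
  also have "\<dots> = integral\<^sup>N (?C \<Otimes>\<^sub>M (?N \<Otimes>\<^sub>M ?S)) f"
    by (subst NS.nn_integral_fst[symmetric]) simp_all
  finally show ?thesis by (simp add: driving_law_def)
qed

text \<open>Strict concavity of the root at 1: the square of the left side is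
  \<open>2 + 2 * sqrt (1 - y\<^sup>2)\<close>.\<close>

lemma sqrt_add_sqrt_less_2:
  assumes "\<bar>y\<bar> \<le> 1" "y \<noteq> (0::real)"
  shows "sqrt (1 - y) + sqrt (1 + y) < 2"
proof (rule power2_less_imp_less)
  have "y\<^sup>2 > 0" using assms by simp
  then have "sqrt (1 - y\<^sup>2) < 1" by simp
  then have "2 * (sqrt (1 - y) * sqrt (1 + y)) < 2"
    by (simp add: real_sqrt_mult[symmetric] algebra_simps power2_eq_square)
  then show "(sqrt (1 - y) + sqrt (1 + y))\<^sup>2 < 2\<^sup>2"
    using assms by (simp add: power2_sum abs_le_iff)
qed simp

text \<open>Averaging over \<open>V\<close> and \<open>- V\<close> replaces the integrand by half of
  \<open>sqrt (1 - y) + sqrt (1 + y)\<close> with \<open>y = q * V(1)\<close>, which is almost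
  surely below 1. The root is essential, since \<open>1 - y\<close> itself has mean 1.\<close>

lemma nn_integral_sqrt_shrink_less_1:
  fixes e :: "'d::finite"
  assumes "\<Delta> > 0"
  shows "(\<integral>\<^sup>+ x. ennreal (sqrt (max 0 (shrink l \<Delta> e x))) \<partial>driving_law) < 1"
proof -
  let ?D = "driving_law :: ((nat \<Rightarrow> real) \<times> real \<times> (real^'d)) measure"
  define f where "f x = ennreal (sqrt (max 0 (shrink l \<Delta> e x)))" for x
  define f' where "f' x = f (fst x, fst (snd x), - snd (snd x))" for x
  interpret prob_space ?D by (rule prob_space_driving_law)
  have [measurable]: "f \<in> borel_measurable ?D" unfolding f_def by measurable
  have flip: "(\<lambda>x. (fst x, fst (snd x), - snd (snd x))) \<in> measurable ?D ?D"
    unfolding driving_law_def by measurable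
  have [measurable]: "f' \<in> borel_measurable ?D"
    unfolding f'_def by (rule measurable_compose[OF flip]) measurable
  have sum_less: "AE x in ?D. f x + f' x < 2"
    using AE_driving_law_cube AE_driving_law_sphere[of e]
  proof eventually_elim
    case (elim x)
    obtain u g v where x: "x = (u, g, v)" by (cases x) auto
    let ?k = "kappa CARD('d) l \<Delta>"
    let ?P = "\<Prod>i\<in>{1..cube_dim CARD('d)}. u i"
    define q where "q = psi CARD('d) ?k (time_step CARD('d) ?k u g)"
    have P: "0 < ?P" "?P < 1" using prod_unit_interval[of "CARD('d)" u] elim by (simp_all add: x)
    have q: "0 < q" "q < 1"
      unfolding q_def
      using psi_bounds(1)[OF _ _ P] psi_kappa_less_1[OF _ \<open>\<Delta> > 0\<close> P] kappa_pos[of "CARD('d)", OF _ \<open>\<Delta> > 0\<close>]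
      by simp_all
    define y where "y = q * v $ e"
    have y: "\<bar>y\<bar> \<le> 1" "y \<noteq> 0" using q elim by (auto simp: y_def x abs_mult intro: mult_le_one)
    have "f x + f' x = ennreal (sqrt (1 - y)) + ennreal (sqrt (1 + y))"
      using y by (simp add: f_def f'_def shrink_def x y_def q_def abs_le_iff)
    also have "\<dots> = ennreal (sqrt (1 - y) + sqrt (1 + y))"
      using y by (intro ennreal_plus[symmetric]) (auto simp: abs_le_iff)
    also have "\<dots> < ennreal 2" using sqrt_add_sqrt_less_2[OF y] by (intro ennreal_lessI) auto
    finally show ?case by simp
  qed
  have "2 * integral\<^sup>N ?D f = integral\<^sup>N ?D f + integral\<^sup>N ?D f'"
    using nn_integral_driving_law_uminus[of f] by (simp add: f'_def[abs_def] mult_2)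
  also have "\<dots> = (\<integral>\<^sup>+ x. f x + f' x \<partial>?D)" by (rule nn_integral_add[symmetric]) auto
  \<comment> \<open>The strict pointwise bound survives integration because the integral is finite
    and, on a probability space, the reverse inequality cannot hold almost everywhere.\<close>
  also have "\<dots> < (\<integral>\<^sup>+ x. 2 \<partial>?D)"
  proof (rule nn_integral_less)
    have "(\<integral>\<^sup>+ x. f x + f' x \<partial>?D) \<le> (\<integral>\<^sup>+ x. 2 \<partial>?D)"
      using sum_less by (intro nn_integral_mono_AE) (auto intro: less_imp_le)
    also have "\<dots> < \<infinity>" by (simp add: emeasure_space_1)
    finally show "(\<integral>\<^sup>+ x. f x + f' x \<partial>?D) \<noteq> \<infinity>" by simp
    show "AE x in ?D. f x + f' x \<le> 2" using sum_less by (auto intro: less_imp_le)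
    show "\<not> (AE x in ?D. 2 \<le> f x + f' x)"
    proof
      assume "AE x in ?D. 2 \<le> f x + f' x"
      with sum_less have "AE x in ?D. False" by eventually_elim simp
      then show False by simp
    qed
  qed auto
  also have "\<dots> = 2 * 1" by (simp add: emeasure_space_1)
  finally have "2 * integral\<^sup>N ?D f < 2 * 1" .
  then show ?thesis
    unfolding f_def[symmetric] by (metis linorder_not_less mult_left_mono zero_le_numeral)
qed

section \<open>Summing the tail bounds and dominating the number of steps\<close>

text \<open>The source of the logarithm: about \<open>ln b / ln (1 / r)\<close> terms are bounded by
  1. From index \<open>K\<close> on, \<open>b * r ^ K \<le> 1\<close> leaves a plain geometric
  series.\<close>

lemma suminf_min_geometric_le:
  fixes b r :: real
  assumes r: "0 < r" "r < 1" and b: "1 \<le> b"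
  shows "(\<Sum>n. min 1 (ennreal b * ennreal r ^ n)) \<le> ennreal (ln b / ln (1 / r) + 1 + 1 / (1 - r))"
proof -
  define K where "K = nat \<lceil>ln b / ln (1 / r)\<rceil>"
  have lr: "ln (1 / r) > 0" and lb: "ln b \<ge> 0" using r b by simp_all
  have K: "ln b / ln (1 / r) \<le> real K" "real K \<le> ln b / ln (1 / r) + 1"
    using lr lb divide_nonneg_pos[OF lb lr] by (simp_all add: K_def)
  have "ln b \<le> real K * ln (1 / r)" using K(1) lr by (simp add: pos_divide_le_eq)
  also have "\<dots> = ln ((1 / r) ^ K)" using r by (simp add: ln_realpow)
  finally have "b \<le> (1 / r) ^ K" using r b by simp
  then have bK: "b * r ^ K \<le> 1" using r by (simp add: power_one_over field_simps)
  have bK0: "0 \<le> b * r ^ K" using r b by simp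
  let ?f = "\<lambda>n. min 1 (ennreal b * ennreal r ^ n)"
  have "suminf ?f = (\<Sum>n. ?f (n + K)) + sum ?f {..<K}"
    by (rule suminf_offset) (rule summableI)
  also have "\<dots> \<le> (\<Sum>n. ennreal (r ^ n)) + of_nat K"
  proof (rule add_mono)
    show "(\<Sum>n. ?f (n + K)) \<le> (\<Sum>n. ennreal (r ^ n))"
    proof (rule suminf_le)
      fix n
      have "ennreal b * ennreal r ^ (n + K) = ennreal ((b * r ^ K) * r ^ n)"
        using r b by (simp add: ennreal_mult' ennreal_power power_add mult_ac)
      also have "\<dots> \<le> ennreal (r ^ n)"
        using bK bK0 r by (intro ennreal_leI mult_left_le_one_le) auto
      finally show "?f (n + K) \<le> ennreal (r ^ n)" by (simp add: min.coboundedI2)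
    qed (simp_all add: summableI)
    have "sum ?f {..<K} \<le> (\<Sum>n<K. 1)" by (rule sum_mono) simp
    then show "sum ?f {..<K} \<le> of_nat K" by simp
  qed
  also have "(\<Sum>n. ennreal (r ^ n)) = ennreal (1 / (1 - r))"
    using r by (simp add: suminf_ennreal2 suminf_geometric summable_geometric)
  also have "ennreal (1 / (1 - r)) + of_nat K = ennreal (1 / (1 - r) + real K)"
    using r by (simp add: ennreal_of_nat_eq_real_of_nat)
  also have "\<dots> \<le> ennreal (ln b / ln (1 / r) + 1 + 1 / (1 - r))"
    using K(2) by (intro ennreal_leI) simp
  finally show ?thesis .
qed

lemma real_sqrt_prod: "sqrt (\<Prod>x\<in>A. f x) = (\<Prod>x\<in>A. sqrt (f x))"
  by (induction A rule: infinite_finite_induct) (simp_all add: real_sqrt_mult)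

text \<open>The measurable majorant \<open>S\<close> makes it possible to bound the integral of
  \<open>num_steps\<close>, and its values almost surely, without a separate measurability argument
  for the walk.\<close>

lemma num_steps_dominated:
  fixes l :: "real \<Rightarrow> real" and e :: "'d::finite" and U :: "nat \<Rightarrow> 'a \<Rightarrow> nat \<Rightarrow> real" and V :: "nat \<Rightarrow> 'a \<Rightarrow> real^'d"
  assumes l: "antimono_on {0..} l" "l 0 > 0" and "\<Delta> > 0" "\<epsilon> > 0"
    and seq: "driving_sequence M U G V"
  obtains S :: "'a \<Rightarrow> ennreal" where "S \<in> borel_measurable M"
    and "AE \<omega> in M. ennreal_of_enat
           (num_steps l \<Delta> e \<epsilon> (\<lambda>n. U n \<omega>) (\<lambda>n. G n \<omega>) (\<lambda>n. V n \<omega>)) \<le> S \<omega>"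
    and "(\<integral>\<^sup>+ \<omega>. S \<omega> \<partial>M) \<le> (\<Sum>n. min 1 (ennreal (sqrt (l 0 / \<epsilon>))
           * (\<integral>\<^sup>+ x. ennreal (sqrt (max 0 (shrink l \<Delta> e x))) \<partial>driving_law) ^ n))"
proof -
  let ?D = "driving_law :: ((nat \<Rightarrow> real) \<times> real \<times> (real^'d)) measure"
  define X where "X n \<omega> = (U n \<omega>, G n \<omega>, V n \<omega>)" for n \<omega>
  define f where "f x = ennreal (sqrt (max 0 (shrink l \<Delta> e x)))" for x
  define b where "b = sqrt (l 0 / \<epsilon>)"
  interpret prob_space M using seq by (simp add: driving_sequence_def)
  have indep: "indep_vars (\<lambda>_. ?D) X {1..}"
    and law: "\<And>n. n \<ge> 1 \<Longrightarrow> distr M ?D (X n) = ?D"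
    using seq by (simp_all add: driving_sequence_def X_def[abs_def])
  have X: "X n \<in> measurable M ?D" if "n \<ge> 1" for n
    using indep that by (auto simp: indep_vars_def)
  have f[measurable]: "f \<in> borel_measurable ?D" unfolding f_def by measurable
  have fX[measurable]: "(\<lambda>\<omega>. f (X n \<omega>)) \<in> borel_measurable M" if "n \<ge> 1" for n
    using X[OF that] by (rule measurable_compose) (rule f)
  define F where "F n \<omega> = (\<Prod>k=1..n. f (X k \<omega>))" for n \<omega>
  have F[measurable]: "F n \<in> borel_measurable M" for n
    unfolding F_def[abs_def] by (intro borel_measurable_prod_ennreal fX) auto
  have int_F: "(\<integral>\<^sup>+ \<omega>. F n \<omega> \<partial>M) = (integral\<^sup>N ?D f) ^ n" for n
  proof -
    have "indep_vars (\<lambda>_. borel) (\<lambda>k \<omega>. f (X k \<omega>)) {1..n}"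
      by (rule indep_vars_subset[OF indep_vars_compose2[OF indep f]]) auto
    then have "(\<integral>\<^sup>+ \<omega>. F n \<omega> \<partial>M) = (\<Prod>k=1..n. \<integral>\<^sup>+ \<omega>. f (X k \<omega>) \<partial>M)"
      unfolding F_def by (intro indep_vars_nn_integral) auto
    also have "\<dots> = (\<Prod>k=1..n. integral\<^sup>N ?D f)"
    proof (rule prod.cong)
      fix k assume "k \<in> {1..n}"
      then have "k \<ge> 1" by simp
      then show "(\<integral>\<^sup>+ \<omega>. f (X k \<omega>) \<partial>M) = integral\<^sup>N ?D f"
        using nn_integral_distr[OF X, of k f] law[of k] by (simp add: f)
    qed simp
    finally show ?thesis by simp
  qed
  \<comment> \<open>While the walk runs through index \<open>n\<close>, \<open>\<epsilon>\<close> is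
    below \<open>l 0\<close> times the product of the truncated factors. Dividing by
    \<open>\<epsilon>\<close> and taking roots puts the outcome in \<open>A n\<close>, so
    \<open>S\<close> bounds the tail sum of the number of steps.\<close>
  define A where "A n = {\<omega>\<in>space M. 1 \<le> ennreal b * F n \<omega>}" for n
  have A[measurable]: "A n \<in> sets M" for n unfolding A_def by measurable
  define S where "S \<omega> = (\<Sum>n. indicator (A n) \<omega> :: ennreal)" for \<omega>
  show ?thesis
  proof (rule that)
    show [measurable]: "S \<in> borel_measurable M" unfolding S_def[abs_def] by measurable
    \<comment> \<open>The trivial bound 1 is kept next to Markov's: for small \<open>n\<close>
      Markov's bound may be of order \<open>b\<close>, and summing it alone would give a power of
      \<open>1 / \<epsilon>\<close>.\<close>
    have "emeasure M (A n) \<le> min 1 (ennreal b * integral\<^sup>N ?D f ^ n)" for n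
    proof (rule min.boundedI)
      show "emeasure M (A n) \<le> 1" by (rule emeasure_le_1)
      have "emeasure M (A n) \<le> ennreal b * (\<integral>\<^sup>+ \<omega>. F n \<omega> * indicator (space M) \<omega> \<partial>M)"
        unfolding A_def by (rule nn_integral_Markov_inequality) auto
      also have "(\<integral>\<^sup>+ \<omega>. F n \<omega> * indicator (space M) \<omega> \<partial>M) = (\<integral>\<^sup>+ \<omega>. F n \<omega> \<partial>M)"
        by (intro nn_integral_cong) simp
      finally show "emeasure M (A n) \<le> ennreal b * integral\<^sup>N ?D f ^ n" by (simp add: int_F)
    qed
    then have "(\<integral>\<^sup>+ \<omega>. S \<omega> \<partial>M) \<le> (\<Sum>n. min 1 (ennreal b * integral\<^sup>N ?D f ^ n))"
      unfolding S_def by (subst nn_integral_suminf) (auto intro!: suminf_le summableI)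
    then show "(\<integral>\<^sup>+ \<omega>. S \<omega> \<partial>M) \<le> (\<Sum>n. min 1 (ennreal (sqrt (l 0 / \<epsilon>))
           * (\<integral>\<^sup>+ x. ennreal (sqrt (max 0 (shrink l \<Delta> e x))) \<partial>driving_law) ^ n))"
      by (simp add: b_def f_def[abs_def])
    have "AE \<omega> in M. (\<forall>i\<in>{1..cube_dim CARD('d)}. 0 < U n \<omega> i \<and> U n \<omega> i < 1) \<and> \<bar>V n \<omega> $ e\<bar> \<le> 1"
      if "n \<ge> 1" for n
    proof -
      have "AE x in distr M ?D (X n). (\<forall>i\<in>{1..cube_dim CARD('d)}. 0 < fst x i \<and> fst x i < 1)
          \<and> \<bar>snd (snd x) $ e\<bar> \<le> 1"
        unfolding law[OF that] using AE_driving_law_cube AE_driving_law_sphere[of e] by eventually_elim auto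
      from AE_distrD[OF X[OF that] this] show ?thesis by (simp add: X_def)
    qed
    then have "AE \<omega> in M. \<forall>n\<in>{1..}. (\<forall>i\<in>{1..cube_dim CARD('d)}. 0 < U n \<omega> i \<and> U n \<omega> i < 1) \<and> \<bar>V n \<omega> $ e\<bar> \<le> 1"
      by (subst AE_ball_countable) auto
    then show "AE \<omega> in M. ennreal_of_enat
           (num_steps l \<Delta> e \<epsilon> (\<lambda>n. U n \<omega>) (\<lambda>n. G n \<omega>) (\<lambda>n. V n \<omega>)) \<le> S \<omega>"
      using AE_space
    proof eventually_elim
      case (elim \<omega>)
      let ?w = "walk l \<Delta> e \<epsilon> (\<lambda>n. U n \<omega>) (\<lambda>n. G n \<omega>) (\<lambda>n. V n \<omega>)"
      have "\<omega> \<in> A n" if running: "\<And>k. k \<le> n \<Longrightarrow> gap l (?w k) > \<epsilon>" for n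
      proof -
        let ?p = "\<Prod>k=1..n. max 0 (shrink l \<Delta> e (X k \<omega>))"
        have "gap l (?w n) \<le> l 0 * ?p"
          using gap_le_prod_shrink[OF l(1) \<open>\<Delta> > 0\<close> \<open>\<epsilon> > 0\<close>, of "\<lambda>n. U n \<omega>" "\<lambda>n. V n \<omega>" e n "\<lambda>n. G n \<omega>"]
            elim running by (simp add: X_def)
        with running[of n] have "\<epsilon> \<le> l 0 * ?p" by simp
        then have "1 \<le> l 0 / \<epsilon> * ?p" using \<open>\<epsilon> > 0\<close> by (simp add: field_simps)
        then have "1 \<le> sqrt (l 0 / \<epsilon> * ?p)" by simp
        also have "\<dots> = b * (\<Prod>k=1..n. sqrt (max 0 (shrink l \<Delta> e (X k \<omega>))))"
          by (simp only: b_def real_sqrt_mult real_sqrt_prod)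
        finally have "1 \<le> ennreal (b * (\<Prod>k=1..n. sqrt (max 0 (shrink l \<Delta> e (X k \<omega>)))))" by simp
        also have "\<dots> = ennreal b * F n \<omega>"
          using l \<open>\<epsilon> > 0\<close> by (simp add: ennreal_mult F_def f_def b_def prod_nonneg flip: prod_ennreal)
        finally show ?thesis using elim by (simp add: A_def)
      qed
      then have "(if \<forall>k\<le>n. \<not> gap l (?w k) \<le> \<epsilon> then 1 else 0) \<le> (indicator (A n) \<omega> :: ennreal)" for n
        by (simp add: not_le)
      then have "(\<Sum>n. if \<forall>k\<le>n. \<not> gap l (?w k) \<le> \<epsilon> then 1 else 0) \<le> S \<omega>"
        unfolding S_def by (intro suminf_le summableI)
      with ennreal_of_enat_Inf_le[of "\<lambda>n. gap l (?w n) \<le> \<epsilon>"] show ?case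
        unfolding num_steps_def by (simp add: case_prod_beta')
    qed
  qed
qed

section \<open>Almost sure finiteness and the logarithmic bound for the mean\<close>

theorem theorem2p12:
  fixes l l' :: "real \<Rightarrow> real" and \<Delta> :: real and e :: "'d::finite"
  assumes decreasing: "antimono_on {0..} l"
    and derivative: "\<And>t. t \<ge> 0 \<Longrightarrow> (l has_real_derivative l' t) (at t within {0..})"
    and initial: "l 0 > 0"
    and delta_pos: "\<Delta> > 0"
    and bound: "\<And>t. t \<ge> 0 \<Longrightarrow> l' t \<ge> - \<Delta>"
  shows "(\<forall>(M :: 'a measure) U G (V :: nat \<Rightarrow> 'a \<Rightarrow> real^'d) \<epsilon>.
            driving_sequence M U G V \<longrightarrow> \<epsilon> > 0 \<longrightarrow>
            (AE \<omega> in M. num_steps l \<Delta> e \<epsilon> (\<lambda>n. U n \<omega>) (\<lambda>n. G n \<omega>) (\<lambda>n. V n \<omega>) < \<infinity>))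
       \<and> (\<exists>C>0. \<exists>\<epsilon>0>0. \<forall>(M :: 'a measure) U G (V :: nat \<Rightarrow> 'a \<Rightarrow> real^'d) \<epsilon>.
            driving_sequence M U G V \<longrightarrow> 0 < \<epsilon> \<longrightarrow> \<epsilon> \<le> \<epsilon>0 \<longrightarrow>
            (\<integral>\<^sup>+ \<omega>. ennreal_of_enat
                (num_steps l \<Delta> e \<epsilon> (\<lambda>n. U n \<omega>) (\<lambda>n. G n \<omega>) (\<lambda>n. V n \<omega>)) \<partial>M)
              \<le> ennreal (C * \<bar>ln \<epsilon>\<bar>))"
proof -
  let ?\<rho> = "\<integral>\<^sup>+ x. ennreal (sqrt (max 0 (shrink l \<Delta> e x))) \<partial>(driving_law :: (_ \<times> _ \<times> (real^'d)) measure)"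
  obtain r where r: "0 < r" "r < 1" and \<rho>: "?\<rho> \<le> ennreal r"
  proof -
    have \<rho>: "?\<rho> < 1" by (rule nn_integral_sqrt_shrink_less_1[OF delta_pos])
    then obtain r0 where r0: "?\<rho> = ennreal r0" "0 \<le> r0"
      by (cases ?\<rho>) auto
    \<comment> \<open>The maximum with 1/2 keeps \<open>r\<close> positive even when
      \<open>r0\<close> is 0, so that \<open>ln (1 / r)\<close> is meaningful.\<close>
    show ?thesis
      by (rule that[of "max r0 (1 / 2)"]) (use \<rho> r0 in \<open>auto intro: ennreal_leI\<close>)
  qed
  define H where "H b = ln b / ln (1 / r) + 1 + 1 / (1 - r)" for b
  \<comment> \<open>The slack between \<open>a\<close> and \<open>b\<close> covers large
    \<open>\<epsilon>\<close>, where \<open>sqrt (l 0 / \<epsilon>)\<close> may be below 1 and is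
    replaced by its maximum with 1.\<close>
  have H: "(\<Sum>n. min 1 (ennreal a * ?\<rho> ^ n)) \<le> ennreal (H b)" if "a \<le> b" "1 \<le> b" for a b
  proof -
    have "(\<Sum>n. min 1 (ennreal a * ?\<rho> ^ n)) \<le> (\<Sum>n. min 1 (ennreal b * ennreal r ^ n))"
      using that(1) \<rho> by (intro suminf_le summableI min.mono mult_mono power_mono ennreal_leI) auto
    also have "\<dots> \<le> ennreal (H b)"
      unfolding H_def by (rule suminf_min_geometric_le[OF r that(2)])
    finally show ?thesis .
  qed
  show ?thesis
  proof (intro conjI allI impI)
    fix M :: "'a measure" and U G and V :: "nat \<Rightarrow> 'a \<Rightarrow> real^'d" and \<epsilon> :: real
    assume seq: "driving_sequence M U G V" and \<epsilon>: "\<epsilon> > 0"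
    obtain S where S: "S \<in> borel_measurable M"
      "AE \<omega> in M. ennreal_of_enat (num_steps l \<Delta> e \<epsilon> (\<lambda>n. U n \<omega>) (\<lambda>n. G n \<omega>) (\<lambda>n. V n \<omega>)) \<le> S \<omega>"
      "(\<integral>\<^sup>+ \<omega>. S \<omega> \<partial>M) \<le> (\<Sum>n. min 1 (ennreal (sqrt (l 0 / \<epsilon>)) * ?\<rho> ^ n))"
      by (rule num_steps_dominated[OF decreasing initial delta_pos \<epsilon> seq, of e])
    have "(\<integral>\<^sup>+ \<omega>. S \<omega> \<partial>M) \<le> ennreal (H (max 1 (sqrt (l 0 / \<epsilon>))))"
      using S(3) H[of "sqrt (l 0 / \<epsilon>)" "max 1 (sqrt (l 0 / \<epsilon>))"] by (auto intro: order_trans)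
    then have "(\<integral>\<^sup>+ \<omega>. S \<omega> \<partial>M) \<noteq> \<infinity>" by (auto simp: top_unique)
    with S(1) have "AE \<omega> in M. S \<omega> \<noteq> \<infinity>" by (rule nn_integral_PInf_AE)
    with S(2) show "AE \<omega> in M. num_steps l \<Delta> e \<epsilon> (\<lambda>n. U n \<omega>) (\<lambda>n. G n \<omega>) (\<lambda>n. V n \<omega>) < \<infinity>"
    proof eventually_elim
      case (elim \<omega>)
      then show ?case by (cases "num_steps l \<Delta> e \<epsilon> (\<lambda>n. U n \<omega>) (\<lambda>n. G n \<omega>) (\<lambda>n. V n \<omega>)") (auto simp: top_unique)
    qed
  next
    \<comment> \<open>As \<open>ln (exp 1) = 1\<close>, this is the sum of the coefficient
      \<open>1 / ln (1 / r)\<close> and the constant part of \<open>H\<close>. It depends on neither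
      \<open>M\<close> nor \<open>\<epsilon>\<close>.\<close>
    define C where "C = H (exp 1)"
    \<comment> \<open>The entry \<open>exp (- 1)\<close> gives
      \<open>\<bar>ln \<epsilon>\<bar> \<ge> 1\<close>, which absorbs the constant part of
      \<open>H\<close>. The entry \<open>l 0\<close> gives \<open>?b \<ge> 1\<close>. The entry
      \<open>1 / l 0\<close> gives \<open>ln (l 0) \<le> - ln \<epsilon>\<close>, hence
      \<open>ln ?b \<le> \<bar>ln \<epsilon>\<bar>\<close>.\<close>
    define \<epsilon>0 where "\<epsilon>0 = min (exp (- 1)) (min (l 0) (1 / l 0))"
    have lr: "ln (1 / r) > 0" using r by simp
    have "C > 0" unfolding C_def H_def using lr r by (intro add_pos_pos divide_pos_pos) auto
    moreover have "\<epsilon>0 > 0" using initial by (simp add: \<epsilon>0_def)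
    moreover have "(\<integral>\<^sup>+ \<omega>. ennreal_of_enat
                (num_steps l \<Delta> e \<epsilon> (\<lambda>n. U n \<omega>) (\<lambda>n. G n \<omega>) (\<lambda>n. V n \<omega>)) \<partial>M)
              \<le> ennreal (C * \<bar>ln \<epsilon>\<bar>)"
      if seq: "driving_sequence M U G V" and \<epsilon>: "0 < \<epsilon>" "\<epsilon> \<le> \<epsilon>0"
      for M :: "'a measure" and U G and V :: "nat \<Rightarrow> 'a \<Rightarrow> real^'d" and \<epsilon> :: real
    proof -
      let ?b = "sqrt (l 0 / \<epsilon>)"
      obtain S where S: "S \<in> borel_measurable M"
        "AE \<omega> in M. ennreal_of_enat (num_steps l \<Delta> e \<epsilon> (\<lambda>n. U n \<omega>) (\<lambda>n. G n \<omega>) (\<lambda>n. V n \<omega>)) \<le> S \<omega>"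
        "(\<integral>\<^sup>+ \<omega>. S \<omega> \<partial>M) \<le> (\<Sum>n. min 1 (ennreal ?b * ?\<rho> ^ n))"
        by (rule num_steps_dominated[OF decreasing initial delta_pos \<epsilon>(1) seq, of e])
      have b: "1 \<le> ?b" using \<epsilon> by (simp add: \<epsilon>0_def)
      have "ln \<epsilon> \<le> ln (exp (- 1))" using \<epsilon> by (subst ln_le_cancel_iff) (auto simp: \<epsilon>0_def)
      then have ln1: "\<bar>ln \<epsilon>\<bar> \<ge> 1" and ln2: "\<bar>ln \<epsilon>\<bar> = - ln \<epsilon>" by auto
      have "ln \<epsilon> \<le> ln (1 / l 0)" using \<epsilon> initial by (subst ln_le_cancel_iff) (auto simp: \<epsilon>0_def)
      then have "ln (l 0) \<le> - ln \<epsilon>" using initial by (simp add: ln_div)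
      then have "ln ?b \<le> \<bar>ln \<epsilon>\<bar>"
        using initial \<epsilon> ln2 by (simp add: ln_sqrt ln_div)
      then have "ln ?b / ln (1 / r) \<le> \<bar>ln \<epsilon>\<bar> * (1 / ln (1 / r))"
        using lr by (simp add: divide_right_mono)
      moreover have "1 + 1 / (1 - r) \<le> \<bar>ln \<epsilon>\<bar> * (1 + 1 / (1 - r))"
        using ln1 r mult_right_mono[of 1 "\<bar>ln \<epsilon>\<bar>" "1 + 1 / (1 - r)"] by simp
      ultimately have "H ?b \<le> C * \<bar>ln \<epsilon>\<bar>"
        by (simp add: H_def C_def algebra_simps)
      have "(\<integral>\<^sup>+ \<omega>. ennreal_of_enat
                (num_steps l \<Delta> e \<epsilon> (\<lambda>n. U n \<omega>) (\<lambda>n. G n \<omega>) (\<lambda>n. V n \<omega>)) \<partial>M) \<le> (\<integral>\<^sup>+ \<omega>. S \<omega> \<partial>M)"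
        using S(2) by (rule nn_integral_mono_AE)
      also note S(3)
      also have "(\<Sum>n. min 1 (ennreal ?b * ?\<rho> ^ n)) \<le> ennreal (H ?b)" using b by (intro H) simp_all
      also have "\<dots> \<le> ennreal (C * \<bar>ln \<epsilon>\<bar>)" by (rule ennreal_leI) fact
      finally show ?thesis .
    qed
    ultimately show "\<exists>C>0. \<exists>\<epsilon>0>0. \<forall>(M :: 'a measure) U G (V :: nat \<Rightarrow> 'a \<Rightarrow> real^'d) \<epsilon>.
            driving_sequence M U G V \<longrightarrow> 0 < \<epsilon> \<longrightarrow> \<epsilon> \<le> \<epsilon>0 \<longrightarrow>
            (\<integral>\<^sup>+ \<omega>. ennreal_of_enat
                (num_steps l \<Delta> e \<epsilon> (\<lambda>n. U n \<omega>) (\<lambda>n. G n \<omega>) (\<lambda>n. V n \<omega>)) \<partial>M)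
              \<le> ennreal (C * \<bar>ln \<epsilon>\<bar>)"
      by blast
  qed
qed

end
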